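(* For every integer $n\ge 2$, \[|\mathrm{SAv}_n(132,3421)|=|\mathrm{SAv}_n(213,4312)|=2n^2-7n+8.\]
   Context: Permutations $\pi\in S_n$ are identified with words $\pi(1)\cdots\pi(n)$. For $\tau\in S_m$, entries $\pi(i_1),\ldots,\pi(i_m)$ with $i_1<\cdots<i_m$ form an occurrence of $\tau$ if for all $j,l$, $\pi(i_j)<\pi(i_l)$ iff $\tau(j)<\tau(l)$; $\pi$ avoids $\tau$ if there is no occurrence. $\mathrm{SAv}_n(\tau_1,\ldots,\tau_r)$ is the set of $\pi\in S_n$ such that both $\pi$ and $\pi^2=\pi\circ\pi$ avoid each of $\tau_1,\ldots,\tau_r$. *)

theory Defs
  imports "HOL-Combinatorics.Permutations"
begin

text \<open>
  A pattern \<open>\<tau>\<close> in \<open>S\<^sub>m\<close> is given by its one-line word \<open>[\<tau> 1, \<dots>, \<tau> m]\<close>; a permutation in \<open>S\<^sub>n\<close> is a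
  function \<open>\<pi>\<close> with \<open>\<pi> permutes {1..n}\<close>. Positions in a pattern are numbered from \<open>0\<close>, as are list
  entries, while positions in \<open>\<pi>\<close> are numbered from \<open>1\<close>.
\<close>

definition occurrence :: "nat list \<Rightarrow> nat \<Rightarrow> (nat \<Rightarrow> nat) \<Rightarrow> (nat \<Rightarrow> nat) \<Rightarrow> bool" where
  "occurrence \<tau> n \<pi> i \<longleftrightarrow>
     (\<forall>j < length \<tau>. i j \<in> {1..n}) \<and>
     strict_mono_on {..<length \<tau>} i \<and>
     (\<forall>j < length \<tau>. \<forall>l < length \<tau>. \<pi> (i j) < \<pi> (i l) \<longleftrightarrow> \<tau> ! j < \<tau> ! l)"

definition avoids :: "nat \<Rightarrow> (nat \<Rightarrow> nat) \<Rightarrow> nat list \<Rightarrow> bool" where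
  "avoids n \<pi> \<tau> \<longleftrightarrow> \<not> (\<exists>i. occurrence \<tau> n \<pi> i)"

definition SAv :: "nat \<Rightarrow> nat list set \<Rightarrow> (nat \<Rightarrow> nat) set" where
  "SAv n T = {\<pi>. \<pi> permutes {1..n} \<and> (\<forall>\<tau>\<in>T. avoids n \<pi> \<tau> \<and> avoids n (\<pi> \<circ> \<pi>) \<tau>)}"

end

theory Submission
  imports Defs
begin

text \<open>
  A permutation \<open>\<pi>\<close> in \<open>SAv\<^sub>n(132,3421)\<close> that fixes \<open>n\<close> is just an element of \<open>SAv\<^sub>n\<^sub>-\<^sub>1(132,3421)\<close>.
  Otherwise \<open>n\<close> is at some position \<open>m < n\<close>; avoiding 132 makes the entries left of \<open>n\<close> larger than
  those to its right, and for \<open>m \<ge> 2\<close> avoiding 3421 makes the right part \<open>1 2 \<dots> (n-m)\<close>. Playing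
  these facts for \<open>\<pi>\<close> and \<open>\<pi>\<^sup>2\<close> against each other leaves the \<open>n-1\<close> nontrivial rotations and the words
  \<open>n \<sigma> 1\<close>, \<open>(n-1) \<sigma> n 1\<close> and \<open>n \<sigma> 1 (n-1)\<close>, where the nonempty word \<open>\<sigma>\<close> reverses a nonempty initial
  segment and fixes the rest: \<open>\<sigma>\<close> and \<open>\<sigma>\<^sup>2\<close> avoid both 132 and 231, so the maximum of either is at
  one of its ends.
  This yields \<open>(n-1) + (n-2) + 2(n-3)\<close> permutations not fixing \<open>n\<close>.
  Conjugation by \<open>i \<mapsto> n+1-i\<close> commutes with squaring and exchanges the two pattern sets.
\<close>

section \<open>Containment of 132, 231 and 3421 within a set of positions\<close>

definition has132 :: "nat set \<Rightarrow> (nat \<Rightarrow> nat) \<Rightarrow> bool" where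
  "has132 A f \<longleftrightarrow> (\<exists>a\<in>A. \<exists>b\<in>A. \<exists>c\<in>A. a < b \<and> b < c \<and> f a < f c \<and> f c < f b)"

definition has231 :: "nat set \<Rightarrow> (nat \<Rightarrow> nat) \<Rightarrow> bool" where
  "has231 A f \<longleftrightarrow> (\<exists>a\<in>A. \<exists>b\<in>A. \<exists>c\<in>A. a < b \<and> b < c \<and> f c < f a \<and> f a < f b)"

definition has3421 :: "nat set \<Rightarrow> (nat \<Rightarrow> nat) \<Rightarrow> bool" where
  "has3421 A f \<longleftrightarrow> (\<exists>a\<in>A. \<exists>b\<in>A. \<exists>c\<in>A. \<exists>d\<in>A.
     a < b \<and> b < c \<and> c < d \<and> f d < f c \<and> f c < f a \<and> f a < f b)"

lemma has132I:
  "\<lbrakk>a \<in> A; b \<in> A; c \<in> A; a < b; b < c; f a < f c; f c < f b\<rbrakk> \<Longrightarrow> has132 A f"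
  unfolding has132_def by blast

lemma has231I:
  "\<lbrakk>a \<in> A; b \<in> A; c \<in> A; a < b; b < c; f c < f a; f a < f b\<rbrakk> \<Longrightarrow> has231 A f"
  unfolding has231_def by blast

lemma has3421I:
  "\<lbrakk>a \<in> A; b \<in> A; c \<in> A; d \<in> A; a < b; b < c; c < d; f d < f c; f c < f a; f a < f b\<rbrakk>
   \<Longrightarrow> has3421 A f"
  unfolding has3421_def by blast

lemma has132_mono: "has132 A f \<Longrightarrow> A \<subseteq> B \<Longrightarrow> has132 B f"
  unfolding has132_def by blast

lemma has231_mono: "has231 A f \<Longrightarrow> A \<subseteq> B \<Longrightarrow> has231 B f"
  unfolding has231_def by blast

lemma has3421_mono: "has3421 A f \<Longrightarrow> A \<subseteq> B \<Longrightarrow> has3421 B f"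
  unfolding has3421_def by blast

text \<open>The 342 of a 3421 is order isomorphic to 231, so an entry \<open>d\<close> to the right
  of \<open>A\<close> and below all its values supplies the 1. This is how avoiding 3421 forbids 231
  on inner blocks.\<close>

lemma has3421_if_has231:
  assumes "has231 A f" "A \<subseteq> B" "d \<in> B" "\<And>a. a \<in> A \<Longrightarrow> a < d \<and> f d < f a"
  shows "has3421 B f"
  using assms unfolding has231_def by (meson has3421I subsetD)

text \<open>Unrolls the quantifiers over the positions of a concrete pattern into finitely many
  comparisons.\<close>

lemma all_less_Suc_conv:
  "(\<forall>j < Suc n. P j) \<longleftrightarrow> P n \<and> (\<forall>j < n. P j)"
  by (auto simp: less_Suc_eq)

lemma avoids_132_iff: "avoids n f [1,3,2] \<longleftrightarrow> \<not> has132 {1..n} f"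
proof -
  have "\<exists>i. occurrence [1,3,2] n f i" if H: "has132 {1..n} f"
  proof -
    obtain a b c where "a \<in> {1..n}" "b \<in> {1..n}" "c \<in> {1..n}" "a < b" "b < c" "f a < f c" "f c < f b"
      using H unfolding has132_def by blast
    then have "occurrence [1,3,2] n f (\<lambda>j. [a,b,c] ! j)"
      by (auto simp: occurrence_def strict_mono_on_def all_less_Suc_conv less_Suc_eq)
    then show ?thesis by blast
  qed
  moreover have "has132 {1..n} f" if "occurrence [1,3,2] n f i" for i
  proof -
    have 1: "\<forall>j<3. i j \<in> {1..n}" and 2: "strict_mono_on {..<3} i"
      and 3: "\<forall>j<3. \<forall>l<3. f (i j) < f (i l) \<longleftrightarrow> [1,3,2::nat] ! j < [1,3,2] ! l"
      using that by (auto simp: occurrence_def eval_nat_numeral)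
    have "i 0 < i 1" "i 1 < i 2"
      by (rule strict_mono_onD[OF 2]; simp)+
    moreover have "f (i 0) < f (i 2)" using 3[rule_format, of 0 2] by simp
    moreover have "f (i 2) < f (i 1)" using 3[rule_format, of 2 1] by simp
    ultimately show ?thesis
      using 1 by (intro has132I[of "i 0" _ "i 1" "i 2"]) auto
  qed
  ultimately show ?thesis unfolding avoids_def by blast
qed

lemma avoids_3421_iff: "avoids n f [3,4,2,1] \<longleftrightarrow> \<not> has3421 {1..n} f"
proof -
  have "\<exists>i. occurrence [3,4,2,1] n f i" if H: "has3421 {1..n} f"
  proof -
    obtain a b c d where "a \<in> {1..n}" "b \<in> {1..n}" "c \<in> {1..n}" "d \<in> {1..n}"
      "a < b" "b < c" "c < d" "f d < f c" "f c < f a" "f a < f b"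
      using H unfolding has3421_def by blast
    then have "occurrence [3,4,2,1] n f (\<lambda>j. [a,b,c,d] ! j)"
      by (auto simp: occurrence_def strict_mono_on_def all_less_Suc_conv less_Suc_eq)
    then show ?thesis by blast
  qed
  moreover have "has3421 {1..n} f" if "occurrence [3,4,2,1] n f i" for i
  proof -
    have 1: "\<forall>j<4. i j \<in> {1..n}" and 2: "strict_mono_on {..<4} i"
      and 3: "\<forall>j<4. \<forall>l<4. f (i j) < f (i l) \<longleftrightarrow> [3,4,2,1::nat] ! j < [3,4,2,1] ! l"
      using that by (auto simp: occurrence_def eval_nat_numeral)
    have "i 0 < i 1" "i 1 < i 2" "i 2 < i 3"
      by (rule strict_mono_onD[OF 2]; simp)+
    moreover have "f (i 3) < f (i 2)" using 3[rule_format, of 3 2] by simp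
    moreover have "f (i 2) < f (i 0)" using 3[rule_format, of 2 0] by simp
    moreover have "f (i 0) < f (i 1)" using 3[rule_format, of 0 1] by simp
    ultimately show ?thesis
      using 1 by (intro has3421I[of "i 0" _ "i 1" "i 2" "i 3"]) auto
  qed
  ultimately show ?thesis unfolding avoids_def by blast
qed

section \<open>Increasing runs without slack, and words without an inner peak\<close>

lemma strict_mono_on_interval_ge:
  fixes f :: "nat \<Rightarrow> nat"
  assumes "strict_mono_on {l..u} f" "l \<le> i" "i \<le> j" "j \<le> u"
  shows "f i + (j - i) \<le> f j"
  using assms(3,4)
proof (induction j rule: dec_induct)
  case (step k)
  have "f k < f (Suc k)"
    by (rule strict_mono_onD[OF assms(1)]) (use step assms(2) in auto)
  with step show ?case by auto
qed simp

text \<open>The values grow by at least one per step on both sides of \<open>i\<close>, and the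
  bounds at the two ends leave no room for more.\<close>

lemma strict_mono_on_interval_eq:
  fixes f :: "nat \<Rightarrow> nat"
  assumes "strict_mono_on {l..u} f" "l \<le> i" "i \<le> u" "l' \<le> f l" "f u \<le> l' + (u - l)"
  shows "f i = l' + (i - l)"
  using strict_mono_on_interval_ge[OF assms(1), of l i] strict_mono_on_interval_ge[OF assms(1), of i u]
    assms(2-5) by linarith

text \<open>
  Neither \<open>f\<close> nor \<open>f \<circ> f\<close> can have its maximum strictly inside, so either \<open>f b = b\<close>, or \<open>f\<close> swaps \<open>a\<close>
  and \<open>b\<close> and is then decreasing.
\<close>

lemma valley_classification:
  fixes f :: "nat \<Rightarrow> nat"
  assumes "a \<le> b" "bij_betw f {a..b} {a..b}"
    "\<not> has132 {a..b} f" "\<not> has231 {a..b} f"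
    "\<not> has132 {a..b} (f \<circ> f)" "\<not> has231 {a..b} (f \<circ> f)"
  shows "\<exists>r\<in>{a..b}. \<forall>i\<in>{a..b}. f i = (if i \<le> r then a + r - i else i)"
  using assms
proof (induction b rule: dec_induct)
  case base
  have "f a = a" using bij_betw_imp_surj_on[OF base(1)] by simp
  then show ?case by simp
next
  case (step b)
  let ?I = "{a..Suc b}"
  have im: "f i \<in> ?I" if "i \<in> ?I" for i
    using step.prems(1) that by (auto simp: bij_betw_def)
  have inj: "i = j" if "i \<in> ?I" "j \<in> ?I" "f i = f j" for i j
    using step.prems(1) that by (auto simp: bij_betw_def inj_on_def)
  \<comment> \<open>A maximum strictly inside forms 132 or 231 with the two end entries, according
    to which of them is smaller.\<close>
  have top: "g (Suc b) = Suc b \<or> g a = Suc b"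
    if g: "bij_betw g ?I ?I" "\<not> has132 ?I g" "\<not> has231 ?I g" for g
  proof (rule ccontr)
    assume *: "\<not> ?thesis"
    have "Suc b \<in> g ` ?I" using bij_betw_imp_surj_on[OF g(1)] step.hyps by simp
    then obtain x where x: "x \<in> ?I" "g x = Suc b" by force
    with * have "a < x" "x < Suc b" by (auto simp: le_less)
    moreover have "g a \<in> ?I" "g (Suc b) \<in> ?I" "inj_on g ?I"
      using g(1) step.hyps by (auto simp: bij_betw_def)
    moreover from this have "g a \<noteq> g (Suc b)"
      using step.hyps by (auto dest: inj_onD)
    ultimately show False
      using x * g(2,3) has132I[of a ?I x "Suc b" g] has231I[of a ?I x "Suc b" g] step.hyps
      by (cases "g a < g (Suc b)") (auto simp: le_less)
  qed
  show ?case
  proof (cases "f (Suc b) = Suc b")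
    case True
    have sub: "{a..b} \<subseteq> ?I" by auto
    have "bij_betw f (?I - {Suc b}) (?I - {f (Suc b)})"
      using step.prems(1) step.hyps by (intro bij_betw_DiffI) (auto simp: bij_betw_def)
    moreover have "?I - {Suc b} = {a..b}" by auto
    ultimately have "bij_betw f {a..b} {a..b}" using True by simp
    then obtain r where r: "r \<in> {a..b}" "\<forall>i\<in>{a..b}. f i = (if i \<le> r then a + r - i else i)"
      using step.IH step.prems has132_mono[OF _ sub] has231_mono[OF _ sub] by blast
    show ?thesis
      by (rule bexI[of _ r]) (use r True in \<open>auto simp: le_Suc_eq\<close>)
  next
    case False
    then have fa: "f a = Suc b" using top[of f] step.prems by blast
    have "bij_betw (f \<circ> f) ?I ?I" using step.prems(1) by (rule bij_betw_trans[OF _ step.prems(1)])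
    \<comment> \<open>The other alternative, \<open>f (f a) = Suc b\<close>, would read
      \<open>f (Suc b) = Suc b\<close>, which this case excludes.\<close>
    then have "f (f (Suc b)) = Suc b" using top[of "f \<circ> f"] step.prems False fa by auto
    then have fb: "f (Suc b) = a" using inj[of "f (Suc b)" a] im[of "Suc b"] fa step.hyps by auto
    \<comment> \<open>An ascent followed by the last entry, which is the minimum \<open>a\<close>,
      would be a 231.\<close>
    have dec: "f j < f i" if "i \<in> ?I" "j \<in> ?I" "i < j" for i j
    proof (rule ccontr)
      assume "\<not> ?thesis"
      then have lt: "f i < f j" using inj[of i j] that by fastforce
      have "f j \<le> Suc b" "a \<le> f i" using im that by auto
      then have "a < i" "j < Suc b" using lt that fa fb by (auto simp: le_less)
      moreover have "a < f i" using inj[of i "Suc b"] fb that \<open>a \<le> f i\<close> by (force simp: le_less)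
      ultimately show False
        using has231I[of i ?I j "Suc b" f] step.prems(3) fb lt that by auto
    qed
    \<comment> \<open>Complementing the values makes the word increasing, so that the squeeze for
      increasing runs applies.\<close>
    have sm: "strict_mono_on ?I (\<lambda>i. a + Suc b - f i)"
    proof (rule strict_mono_onI)
      fix i j assume *: "i \<in> ?I" "j \<in> ?I" "i < j"
      show "a + Suc b - f i < a + Suc b - f j"
        using dec[OF *] im[OF *(1)] by auto
    qed
    have "f i = a + Suc b - i" if "i \<in> ?I" for i
      using strict_mono_on_interval_eq[OF sm, of i a] im[OF that] that fa fb by auto
    then show ?thesis using step.hyps by (intro bexI[of _ "Suc b"]) auto
  qed
qed

section \<open>Classification\<close>

text \<open>Addition of \<open>k\<close> modulo \<open>n\<close> on the representatives
  \<open>1\<close> to \<open>n\<close>; both \<open>k = 0\<close> and \<open>k = n\<close> give the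
  identity.\<close>

definition rot :: "nat \<Rightarrow> nat \<Rightarrow> nat \<Rightarrow> nat" where
  "rot n k i = (if 1 \<le> i \<and> i \<le> n - k then i + k else if n - k < i \<and> i \<le> n then i - (n - k) else i)"

text \<open>
  With \<open>\<sigma>\<close> the word of \<open>valley r\<close> on the middle positions, \<open>valley_swap\<close>, \<open>valley_cycle\<close> and
  \<open>valley_cycle_inv\<close> are \<open>n \<sigma> 1\<close>, \<open>(n-1) \<sigma> n 1\<close> and \<open>n \<sigma> 1 (n-1)\<close>.
\<close>

definition valley :: "nat \<Rightarrow> nat \<Rightarrow> nat" where
  "valley r i = (if 2 \<le> i \<and> i \<le> r then r + 2 - i else i)"

definition valley_swap :: "nat \<Rightarrow> nat \<Rightarrow> nat \<Rightarrow> nat" where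
  "valley_swap n r i = (if i = 1 then n else if i = n then 1 else valley r i)"

definition valley_cycle :: "nat \<Rightarrow> nat \<Rightarrow> nat \<Rightarrow> nat" where
  "valley_cycle n r i =
     (if i = 1 then n - 1 else if i = n - 1 then n else if i = n then 1 else valley r i)"

definition valley_cycle_inv :: "nat \<Rightarrow> nat \<Rightarrow> nat \<Rightarrow> nat" where
  "valley_cycle_inv n r i =
     (if i = 1 then n else if i = n - 1 then 1 else if i = n then n - 1 else valley r i)"

section \<open>Entries around the maximum, and runs forced by avoiding 132\<close>

lemma permutes_interval_facts:
  assumes "p permutes {1..n::nat}"
  shows "1 \<le> i \<Longrightarrow> i \<le> n \<Longrightarrow> 1 \<le> p i \<and> p i \<le> n"
    and "p i = p j \<longleftrightarrow> i = j"
    and "1 \<le> v \<Longrightarrow> v \<le> n \<Longrightarrow> \<exists>i. 1 \<le> i \<and> i \<le> n \<and> p i = v"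
    and "\<not> (1 \<le> i \<and> i \<le> n) \<Longrightarrow> p i = i"
proof -
  show "1 \<le> i \<Longrightarrow> i \<le> n \<Longrightarrow> 1 \<le> p i \<and> p i \<le> n"
    using permutes_in_image[OF assms, of i] by auto
  show "p i = p j \<longleftrightarrow> i = j" using permutes_inj[OF assms] by (auto dest: injD)
  show "\<exists>i. 1 \<le> i \<and> i \<le> n \<and> p i = v" if "1 \<le> v" "v \<le> n"
  proof -
    have "v \<in> p ` {1..n}" unfolding permutes_image[OF assms] using that by simp
    then show ?thesis by auto
  qed
  show "\<not> (1 \<le> i \<and> i \<le> n) \<Longrightarrow> p i = i"
    using permutes_not_in[OF assms, of i] by auto
qed

text \<open>With \<open>n\<close> as the 3, avoiding 132 puts every entry left of \<open>n\<close>
  above every entry right of it; by counting, the entries on the right are the \<open>n - m\<close>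
  smallest values.\<close>

lemma split_at_max:
  assumes p: "p permutes {1..n::nat}" and av: "\<not> has132 {1..n} p"
    and m: "1 \<le> m" "m \<le> n" "p m = n"
  shows "m < j \<Longrightarrow> j \<le> n \<Longrightarrow> p j \<le> n - m"
    and "1 \<le> i \<Longrightarrow> i \<le> m \<Longrightarrow> n - m < p i"
proof -
  note P = permutes_interval_facts[OF p]
  let ?B = "p ` {m<..n}"
  have cB: "card ?B = n - m"
    using permutes_inj[OF p] by (simp add: card_image inj_on_subset)
  have less: "p j < p i" if "1 \<le> i" "i < m" "m < j" "j \<le> n" for i j
  proof (rule ccontr)
    assume "\<not> ?thesis"
    then have "p i < p j" using P(2)[of i j] that by force
    moreover have "p j < p m" using P(1)[of j] P(2)[of j m] that m by force
    ultimately show False using av has132I[of i "{1..n}" m j p] that m by auto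
  qed
  have small: "p j \<le> n - m" if j: "m < j" "j \<le> n" for j
  proof -
    \<comment> \<open>Entries left of \<open>m\<close> exceed \<open>p j\<close>, so all values up
      to \<open>p j\<close> sit to the right of \<open>m\<close>, where there is room for only
      \<open>n - m\<close> of them.\<close>
    have "{1..p j} \<subseteq> ?B"
    proof
      fix v assume v: "v \<in> {1..p j}"
      then obtain i where i: "1 \<le> i" "i \<le> n" "p i = v"
        using P(3)[of v] P(1)[of j] j by force
      have "p j < n" using P(1)[of j] P(2)[of j m] j m by force
      then have "\<not> i \<le> m" using less[of i j] i v m j by (cases "i = m") auto
      then show "v \<in> ?B" using i by auto
    qed
    then have "card {1..p j} \<le> card ?B" by (intro card_mono) auto
    then show ?thesis using cB by simp
  qed
  then show "m < j \<Longrightarrow> j \<le> n \<Longrightarrow> p j \<le> n - m" .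
  have "?B \<subseteq> {1..n - m}" using small P(1) by fastforce
  then have "?B = {1..n - m}" using cB by (intro card_subset_eq) auto
  then show "n - m < p i" if "1 \<le> i" "i \<le> m"
  proof -
    have "p i \<notin> ?B" using P(2) that by auto
    with \<open>?B = _\<close> show ?thesis using P(1)[of i] that m by auto
  qed
qed

text \<open>A descent after \<open>n\<close> would complete the first entry and \<open>n\<close> to
  a 3421; \<open>2 \<le> m\<close> makes these two distinct. So the tail increases through the
  values \<open>1\<close> to \<open>n - m\<close>.\<close>

lemma tail_after_max:
  assumes p: "p permutes {1..n::nat}" and av: "\<not> has132 {1..n} p" "\<not> has3421 {1..n} p"
    and m: "2 \<le> m" "m \<le> n" "p m = n" and j: "m < j" "j \<le> n"
  shows "p j = j - m"
proof -
  note P = permutes_interval_facts[OF p]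
  have m1: "1 \<le> m" using m by simp
  note S = split_at_max[OF p av(1) m1 m(2,3)]
  have "strict_mono_on {m+1..n} p"
  proof (rule strict_mono_onI)
    fix x y assume xy: "x \<in> {m+1..n}" "y \<in> {m+1..n}" "x < y"
    show "p x < p y"
    proof (rule ccontr)
      assume "\<not> ?thesis"
      then have "p y < p x" using P(2)[of x y] xy by force
      moreover have "p x < p 1" using S(1)[of x] S(2)[of 1] xy m by auto
      moreover have "p 1 < p m" using P(1)[of 1] P(2)[of 1 m] m by force
      ultimately show False
        using av(2) has3421I[of 1 "{1..n}" m x y p] xy m by auto
    qed
  qed
  then have "p j = 1 + (j - (m + 1))"
    by (rule strict_mono_on_interval_eq) (use j S(1)[of n] P(1)[of "m+1"] in auto)
  then show ?thesis using j by simp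
qed

text \<open>Brings \<open>valley_classification\<close> to a block that \<open>p\<close> maps to
  itself. Avoidance of 132 is inherited from the whole word, while that of 231 will come from a
  smaller entry to the right of the block or from the square being the identity.\<close>

lemma valley_inner:
  assumes p: "p permutes {1..n::nat}" and "2 \<le> u" "u \<le> n"
    and av: "\<not> has132 {1..n} p" "\<not> has132 {1..n} (p \<circ> p)"
      "\<not> has231 {2..u} p" "\<not> has231 {2..u} (p \<circ> p)"
    and im: "\<And>i. 2 \<le> i \<Longrightarrow> i \<le> u \<Longrightarrow> 2 \<le> p i \<and> p i \<le> u"
  shows "\<exists>r\<in>{2..u}. \<forall>i\<in>{2..u}. p i = valley r i"
proof -
  have sub: "{2..u} \<subseteq> {1..n}" using assms by auto
  have "inj_on p {2..u}" using permutes_inj[OF p] by (rule inj_on_subset) simp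
  moreover have "p ` {2..u} \<subseteq> {2..u}" using im by auto
  ultimately have "bij_betw p {2..u} {2..u}"
    by (simp add: bij_betw_def endo_inj_surj)
  then show ?thesis
    using valley_classification[OF \<open>2 \<le> u\<close>, of p] av has132_mono[OF _ sub]
    by (fastforce simp: valley_def)
qed


text \<open>The \<open>m\<close> entries of the prefix exceed \<open>n - m\<close> and end in
  \<open>n\<close>, so increasing order determines them.\<close>

lemma eq_rot_if_increasing_prefix:
  assumes p: "p permutes {1..n::nat}" and av: "\<not> has132 {1..n} p"
    and m: "1 \<le> m" "m \<le> n" "p m = n"
    and tail: "\<And>j. m < j \<Longrightarrow> j \<le> n \<Longrightarrow> p j = j - m" and inc: "strict_mono_on {1..m} p"
  shows "p = rot n (n - m)"
proof
  fix i
  note P = permutes_interval_facts[OF p]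
  have "p i = i + (n - m)" if "1 \<le> i" "i \<le> m"
    using strict_mono_on_interval_eq[OF inc, of i "n - m + 1"] split_at_max(2)[OF p av m, of 1] that m
    by auto
  then show "p i = rot n (n - m) i" using tail[of i] P(4)[of i] m by (auto simp: rot_def)
qed

text \<open>A descent after the least entry would be the 32 of a 132.\<close>

lemma strict_mono_on_if_first_least:
  assumes p: "p permutes {1..n::nat}" and av: "\<not> has132 {1..n} p"
    and x: "1 \<le> x" "y \<le> n" and lb: "\<And>i. x < i \<Longrightarrow> i \<le> y \<Longrightarrow> p x < p i"
  shows "strict_mono_on {x..y} p"
proof (rule strict_mono_onI)
  note P = permutes_interval_facts[OF p]
  fix i j assume ij: "i \<in> {x..y}" "j \<in> {x..y}" "i < j"
  show "p i < p j"
  proof (cases "i = x")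
    case True
    then show ?thesis using lb ij by auto
  next
    case False
    then have "p x < p j" using lb[of j] ij by auto
    moreover have "p i \<noteq> p j" using P(2) ij by auto
    ultimately show ?thesis
      using av has132I[of x "{1..n}" i j p] False ij x by force
  qed
qed

text \<open>The position \<open>q\<close> of the entry \<open>1\<close> decides. If
  \<open>q = 2\<close>, the word is a rotation; otherwise \<open>q = n\<close> gives
  \<open>valley_swap\<close> and \<open>q = n - 1\<close> gives \<open>valley_cycle_inv\<close>. Any
  other \<open>q\<close> contradicts the structure of \<open>p \<circ> p\<close>, whose maximum is
  at \<open>q\<close> when \<open>q < n\<close>.\<close>

lemma max_first_classification:
  assumes p: "p permutes {1..n::nat}" and "n \<ge> 2"
    and av: "\<not> has132 {1..n} p" "\<not> has3421 {1..n} p"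
      "\<not> has132 {1..n} (p \<circ> p)" "\<not> has3421 {1..n} (p \<circ> p)"
    and first: "p 1 = n"
  shows "p = rot n (n - 1) \<or> (\<exists>r\<in>{2..n-1}. p = valley_swap n r)
    \<or> (\<exists>r\<in>{2..n-2}. p = valley_cycle_inv n r)"
proof -
  note P = permutes_interval_facts[OF p]
  have pp: "p \<circ> p permutes {1..n}" using p p by (rule permutes_compose)
  note PP = permutes_interval_facts[OF pp]
  have rotI: ?thesis if two: "p 2 = 1"
  proof -
    have inc: "strict_mono_on {2..n} p"
    proof (rule strict_mono_on_if_first_least[OF p av(1)])
      fix i assume "2 < i" "i \<le> n"
      then show "p 2 < p i" using two P(1)[of i] P(2)[of 2 i] by force
    qed auto
    have "p n \<le> n - 1" using P(1)[of n] P(2)[of n 1] first \<open>n \<ge> 2\<close> by force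
    then have "p j = j - 1" if "1 < j" "j \<le> n" for j
      using strict_mono_on_interval_eq[OF inc, of j 1] two that \<open>n \<ge> 2\<close> by auto
    then show ?thesis
      using eq_rot_if_increasing_prefix[OF p av(1), of 1] first \<open>n \<ge> 2\<close>
      by (auto simp: strict_mono_on_def)
  qed
  show ?thesis
  proof (cases "p n = 1")
    case True
    show ?thesis
    \<comment> \<open>For \<open>n = 2\<close> there is no middle block, and the word
      \<open>2 1\<close> is a rotation.\<close>
    proof (cases "n = 2")
      case False
      \<comment> \<open>As \<open>p\<close> swaps \<open>1\<close> and \<open>n\<close>, its square
        begins with its least entry; avoiding 132 then makes the square the identity.\<close>
      have inc: "strict_mono_on {1..n} (p \<circ> p)"
      proof (rule strict_mono_on_if_first_least[OF pp av(3)])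
        fix i assume "1 < i" "i \<le> n"
        then show "(p \<circ> p) 1 < (p \<circ> p) i"
          using first True PP(1)[of i] PP(2)[of 1 i] by force
      qed auto
      have "(p \<circ> p) n \<le> n" using PP(1)[of n] \<open>n \<ge> 2\<close> by auto
      then have id: "(p \<circ> p) i = i" if "1 \<le> i" "i \<le> n" for i
        using strict_mono_on_interval_eq[OF inc, of i 1] first True that by auto
      have inner: "2 \<le> p i \<and> p i \<le> n - 1" if "2 \<le> i" "i \<le> n - 1" for i
        using P(1)[of i] P(2)[of i 1] P(2)[of i n] first True that by force
      have "\<not> has231 {2..n-1} (p \<circ> p)"
        unfolding has231_def using id by (force simp del: o_apply)
      moreover have "\<not> has231 {2..n-1} p"
      proof
        assume "has231 {2..n-1} p"
        then have "has3421 {1..n} p"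
          by (rule has3421_if_has231[where d = n]) (use inner True \<open>n \<ge> 2\<close> in force)+
        then show False using av by blast
      qed
      moreover have "2 \<le> n - 1" using \<open>n \<ge> 2\<close> False by simp
      ultimately obtain r where r: "r \<in> {2..n-1}" "\<forall>i\<in>{2..n-1}. p i = valley r i"
        using valley_inner[OF p _ _ av(1) av(3), of "n - 1"] inner by auto
      have "p i = valley_swap n r i" for i
      proof (cases "i \<in> {2..n-1}")
        case True
        then have "i \<noteq> 1" "i \<noteq> n" by auto
        then show ?thesis using r(2) True by (simp add: valley_swap_def)
      next
        case False
        then consider "i = 1" | "i = n" | "i \<noteq> 1" "i \<noteq> n" "\<not> (1 \<le> i \<and> i \<le> n)" by force
        then show ?thesis
        proof cases
          case 3
          then have "\<not> (2 \<le> i \<and> i \<le> r)" using r(1) by auto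
          with 3 show ?thesis using P(4)[of i] by (auto simp: valley_swap_def valley_def)
        qed (use first \<open>p n = 1\<close> \<open>n \<ge> 2\<close> in \<open>simp_all add: valley_swap_def\<close>)
      qed
      then show ?thesis using r(1) by blast
    qed (use True rotI in auto)
  next
    case False
    define c where "c = p n"
    obtain q where q: "1 \<le> q" "q \<le> n" "p q = 1" using P(3)[of 1] \<open>n \<ge> 2\<close> by auto
    have "q \<noteq> 1" using q first \<open>n \<ge> 2\<close> by auto
    moreover have "q \<noteq> n" using q False by auto
    ultimately have q2: "2 \<le> q" "q < n" using q by auto
    have q1: "(p \<circ> p) q = n" using q first by simp
    have tail: "p (p j) = j - q" if "q < j" "j \<le> n" for j
      using tail_after_max[OF pp av(3,4) q2(1) q(2) q1 that] by simp
    have pc: "p c = n - q" using tail[of n] q2 by (simp add: c_def)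
    \<comment> \<open>Both \<open>p (p (q + 1))\<close> and \<open>p q\<close> equal
      \<open>1\<close>, so injectivity applies.\<close>
    have pq: "p (q + 1) = q" using tail[of "q+1"] q2 P(2)[of "p (q+1)" q] q by simp
    have inc: "strict_mono_on {q..n} p"
    proof (rule strict_mono_on_if_first_least[OF p av(1)])
      fix i assume "q < i" "i \<le> n"
      then show "p q < p i" using q P(1)[of i] P(2)[of q i] by force
    qed (use q in auto)
    show ?thesis
    proof (cases "q = n - 1")
      case True
      show ?thesis
      proof (cases "n = 3")
        case False
        have n4: "n \<ge> 4" using False True q2 by simp
        have pn: "p n = n - 1" using pq True n4 by simp
        have inner: "2 \<le> p i \<and> p i \<le> n - 2" if "2 \<le> i" "i \<le> n - 2" for i
        proof -
          have "p i \<noteq> n" "p i \<noteq> 1" "p i \<noteq> n - 1"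
            using P(2)[of i 1] P(2)[of i q] P(2)[of i n] first q pn True that n4 by auto
          then show ?thesis using P(1)[of i] that by linarith
        qed
        have "\<not> has231 {2..n-2} p"
        proof
          assume "has231 {2..n-2} p"
          then have "has3421 {1..n} p"
            by (rule has3421_if_has231[where d = q]) (use inner True q n4 in force)+
          then show False using av by blast
        qed
        moreover have "\<not> has231 {2..n-2} (p \<circ> p)"
        proof
          assume "has231 {2..n-2} (p \<circ> p)"
          \<comment> \<open>The square ends in \<open>p (p n) = p (n - 1) = 1\<close>, which
            supplies the last entry of the 3421.\<close>
          then have "has3421 {1..n} (p \<circ> p)"
          proof (rule has3421_if_has231[where d = n])
            fix i assume i: "i \<in> {2..n-2}"
            then have "2 \<le> p (p i)" using inner[of "p i"] inner[of i] by auto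
            then show "i < n \<and> (p \<circ> p) n < (p \<circ> p) i" using i q pn True n4 by auto
          qed (use n4 in auto)
          then show False using av by blast
        qed
        moreover have "2 \<le> n - 2" using n4 by simp
        ultimately obtain r where r: "r \<in> {2..n-2}" "\<forall>i\<in>{2..n-2}. p i = valley r i"
          using valley_inner[OF p _ _ av(1) av(3), of "n - 2"] inner by auto
        have "p i = valley_cycle_inv n r i" for i
        proof (cases "i \<in> {2..n-2}")
          case True
          then show ?thesis using r by (auto simp: valley_cycle_inv_def)
        next
          case False
          then consider "i = 1" | "i = n - 1" | "i = n" | "\<not> (1 \<le> i \<and> i \<le> n)" by force
          then show ?thesis
            using first q pn True n4 P(4)[of i] r(1)
            by cases (auto simp: valley_cycle_inv_def valley_def)
        qed
        then show ?thesis using r(1) by blast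
      qed (use True q rotI in auto)
    next
      \<comment> \<open>The rest shows that \<open>q = 2\<close>, by comparing the increasing run of
        \<open>p\<close> from \<open>q\<close> on with the known tail of the square.\<close>
      case ne: False
      have cn: "c < n" using P(1)[of n] P(2)[of n 1] first q2 by (force simp: c_def)
      have qc: "q < c" using strict_mono_onD[OF inc, of "q+1" n] pq q2 ne by (auto simp: c_def)
      have inc': "strict_mono_on {q+1..n} p" using inc by (rule monotone_on_subset) auto
      \<comment> \<open>The first entry of the square is \<open>p n = c\<close>, and it stands left
        of the maximum of the square. Growth of \<open>p\<close> from \<open>q + 1\<close> to
        \<open>c\<close> gives the opposite bound, so \<open>n - q = c - 1\<close>.\<close>
      have "n - q < (p \<circ> p) 1" using split_at_max(2)[OF pp av(3) q(1,2) q1, of 1] q by simp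
      then have "n - q < c" using first by (simp add: c_def)
      moreover have "p (q+1) + (c - (q+1)) \<le> p c"
        by (rule strict_mono_on_interval_ge[OF inc']) (use qc cn in auto)
      ultimately have nc: "n - q = c - 1" using pc pq qc by simp
      \<comment> \<open>This value is computed twice: as \<open>p (p c)\<close> from the tail of the
        square, and below from the run between \<open>q + 1\<close> and \<open>c\<close>, which has
        no slack. Equating the two yields \<open>q = 2\<close>.\<close>
      have "p (c - 1) = c - q" using tail[of c] pc nc qc cn by simp
      moreover have "p (c - 1) = c - 2" if "q + 1 < c"
      proof -
        have "strict_mono_on {q+1..c} p" using inc by (rule monotone_on_subset) (use cn in auto)
        then have "p (c - 1) = q + ((c - 1) - (q + 1))"
          by (rule strict_mono_on_interval_eq) (use that pq pc nc in auto)
        then show ?thesis using that by simp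
      qed
      ultimately have "q = 2" if "q + 1 < c" using that q2 by simp
      \<comment> \<open>Here \<open>n = 2 * q\<close>, while growth of \<open>p\<close> up to
        position \<open>n\<close> gives \<open>n - 1 \<le> c = q + 1\<close>.\<close>
      moreover have "q = 2" if "c = q + 1"
      proof -
        have "p (q+1) + (n - (q+1)) \<le> p n"
          by (rule strict_mono_on_interval_ge[OF inc']) (use q2 in auto)
        then show ?thesis using that pq nc q2 ne by (simp add: c_def)
      qed
      ultimately show ?thesis using rotI q qc by force
    qed
  qed
qed

text \<open>An increasing prefix before \<open>n\<close> yields a rotation. It can fail to increase
  only if \<open>n\<close> is next to last and \<open>n - 1\<close> comes first, and then the
  entries between form a valley.\<close>

lemma max_middle_classification:
  assumes p: "p permutes {1..n::nat}"
    and av: "\<not> has132 {1..n} p" "\<not> has3421 {1..n} p"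
      "\<not> has132 {1..n} (p \<circ> p)" "\<not> has3421 {1..n} (p \<circ> p)"
    and m: "2 \<le> m" "m < n" "p m = n"
  shows "p = rot n (n - m) \<or> (\<exists>r\<in>{2..n-2}. p = valley_cycle n r)"
proof -
  note P = permutes_interval_facts[OF p]
  have pp: "p \<circ> p permutes {1..n}" using p p by (rule permutes_compose)
  note PP = permutes_interval_facts[OF pp]
  have m': "1 \<le> m" "m \<le> n" using m by auto
  have tail: "p j = j - m" if "m < j" "j \<le> n" for j
    using tail_after_max[OF p av(1,2) m(1) m'(2) m(3) that] .
  note head = split_at_max(2)[OF p av(1) m' m(3)]
  have rotI: ?thesis if "strict_mono_on {1..m} p"
    using eq_rot_if_increasing_prefix[OF p av(1) m' m(3) tail that] by blast
  show ?thesis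
  proof (cases "n = m + 1")
    case False
    have "p 1 < p 2"
    proof (rule ccontr)
      assume "\<not> ?thesis"
      then have "p 2 < p 1" using P(2)[of 1 2] by force
      moreover have "n - m < p 2" using head[of 2] m by simp
      ultimately have "has132 {1..n} (p \<circ> p)"
        \<comment> \<open>At \<open>m\<close>, \<open>m + 1\<close>, \<open>m + 2\<close> the square
          has the entries \<open>n - m\<close>, \<open>p 1\<close>, \<open>p 2\<close>, with
          \<open>n - m < p 2 < p 1\<close>.\<close>
        using tail[of n] tail[of "m+1"] tail[of "m+2"] m False
        by (intro has132I[of m _ "m+1" "m+2"]) auto
      then show False using av by blast
    qed
    have "strict_mono_on {1..m} p"
    proof (rule strict_mono_on_if_first_least[OF p av(1)])
      fix i assume i: "1 < i" "i \<le> m"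
      show "p 1 < p i"
      proof (rule ccontr)
        assume "\<not> ?thesis"
        then have "p i < p 1" using P(2)[of 1 i] i by force
        moreover have "p (m+1) < p i" using tail[of "m+1"] head[of i] i m by simp
        moreover have "2 < i" using \<open>p 1 < p 2\<close> \<open>p i < p 1\<close> i by (cases "i = 2") auto
        ultimately have "has3421 {1..n} p"
          using \<open>p 1 < p 2\<close> i m by (intro has3421I[of 1 _ 2 i "m+1"]) auto
        then show False using av by blast
      qed
    qed (use m in auto)
    then show ?thesis by (rule rotI)
  next
    case True
    have pn: "p n = 1" using tail[of n] True by simp
    have ppm: "(p \<circ> p) m = 1" using pn m by simp
    \<comment> \<open>Since \<open>p (n - 1) = n\<close>, the position of \<open>n - 1\<close> in
      \<open>p\<close> is that of the maximum in the square.\<close>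
    obtain q where q: "1 \<le> q" "q \<le> n" "p q = n - 1" using P(3)[of "n-1"] m(1,2) by force
    have ppq: "(p \<circ> p) q = n" using q True m by simp
    have "q \<noteq> n" "q \<noteq> m" using q pn m by auto
    then have qm: "q < m" using q True by simp
    show ?thesis
    proof (cases "q = 1")
      case False
      then have q2: "2 \<le> q" using q by simp
      note tail2 = tail_after_max[OF pp av(3,4) q2 q(2) ppq]
      \<comment> \<open>The square has the entry \<open>p n = 1\<close> at \<open>m\<close>, so its
        tail starts there; its last entry is \<open>p 1\<close>.\<close>
      have mq: "m - q = 1" using tail2[of m] ppm qm m by simp
      have "p 1 = n - q" using tail2[of n] pn qm m by simp
      then have one: "p 1 = 2" using mq True by simp
      have "strict_mono_on {1..m} p"
      proof (rule strict_mono_on_if_first_least[OF p av(1)])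
        fix i assume "1 < i" "i \<le> m"
        then show "p 1 < p i" using one P(1)[of i] P(2)[of 1 i] P(2)[of i n] pn m by force
      qed (use m in auto)
      then show ?thesis by (rule rotI)
    next
      case q1: True
      show ?thesis
      proof (cases "n = 3")
        case 3: True
        then have "m = 2" "p 1 = 2" "p 2 = 3" using True q q1 m by auto
        then have "strict_mono_on {1..m} p"
          by (auto simp: strict_mono_on_def le_Suc_eq numeral_2_eq_2)
        then show ?thesis by (rule rotI)
      next
        case False
        then have n4: "n \<ge> 4" using True m by simp
        have pm: "p 1 = n - 1" "p (n - 1) = n" using q q1 True m by auto
        have inner: "2 \<le> p i \<and> p i \<le> n - 2" if "2 \<le> i" "i \<le> n - 2" for i
        proof -
          have "p i \<noteq> n" "p i \<noteq> 1" "p i \<noteq> n - 1"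
            using P(2)[of i 1] P(2)[of i m] P(2)[of i n] pm m pn True that n4 by auto
          then show ?thesis using P(1)[of i] that by linarith
        qed
        have "\<not> has231 {2..n-2} p"
        proof
          assume "has231 {2..n-2} p"
          then have "has3421 {1..n} p"
            by (rule has3421_if_has231[where d = n]) (use inner pn n4 in force)+
          then show False using av by blast
        qed
        moreover have "\<not> has231 {2..n-2} (p \<circ> p)"
        proof
          assume "has231 {2..n-2} (p \<circ> p)"
          then have "has3421 {1..n} (p \<circ> p)"
          proof (rule has3421_if_has231[where d = m])
            fix i assume i: "i \<in> {2..n-2}"
            then have "2 \<le> p (p i)" using inner[of "p i"] inner[of i] by auto
            then show "i < m \<and> (p \<circ> p) m < (p \<circ> p) i" using i ppm True n4 by auto
          qed (use n4 m in auto)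
          then show False using av by blast
        qed
        moreover have "2 \<le> n - 2" using n4 by simp
        ultimately obtain r where r: "r \<in> {2..n-2}" "\<forall>i\<in>{2..n-2}. p i = valley r i"
          using valley_inner[OF p _ _ av(1) av(3), of "n - 2"] inner by auto
        have "p i = valley_cycle n r i" for i
        proof (cases "i \<in> {2..n-2}")
          case True
          then show ?thesis using r by (auto simp: valley_cycle_def)
        next
          case False
          then consider "i = 1" | "i = n - 1" | "i = n" | "\<not> (1 \<le> i \<and> i \<le> n)" by force
          then show ?thesis
            using pm pn n4 P(4)[of i] r(1)
            by cases (auto simp: valley_cycle_def valley_def)
        qed
        then show ?thesis using r(1) by blast
      qed
    qed
  qed
qed


section \<open>Enumeration\<close>

lemma mem_SAv_132_3421_iff:
  "p \<in> SAv n {[1,3,2], [3,4,2,1]} \<longleftrightarrow> p permutes {1..n} \<and>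
     \<not> has132 {1..n} p \<and> \<not> has3421 {1..n} p \<and> \<not> has132 {1..n} (p \<circ> p) \<and> \<not> has3421 {1..n} (p \<circ> p)"
  unfolding SAv_def ball_simps avoids_132_iff avoids_3421_iff by blast

lemma permutes_if_inj_on_endo:
  assumes "finite A" "\<And>i. i \<in> A \<Longrightarrow> f i \<in> A" "\<And>i. i \<notin> A \<Longrightarrow> f i = i" "inj_on f A"
  shows "f permutes A"
proof (rule bij_imp_permutes)
  have "f ` A = A" using assms by (intro endo_inj_surj) auto
  then show "bij_betw f A A" using assms by (simp add: bij_betw_def)
qed (rule assms)

section \<open>Rotations belong to the set\<close>

lemma rot_permutes:
  assumes "k \<le> n"
  shows "rot n k permutes {1..n}"
proof (rule permutes_if_inj_on_endo)
  show "inj_on (rot n k) {1..n}"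
    by (rule inj_on_inverseI[of _ "rot n (n - k)"]) (use assms in \<open>auto simp: rot_def\<close>)
qed (use assms in \<open>auto simp: rot_def\<close>)

text \<open>The word consists of two increasing runs, the first above the second, so a pair descends
  exactly when it straddles the cut. In 132 the 1 and the 3 would share the left run, yet the 2 on
  the right exceeds the 1; in 3421 the 2 would have to lie on both sides.\<close>

lemma rot_avoids:
  assumes "k \<le> n"
  shows "\<not> has132 {1..n} (rot n k)" "\<not> has3421 {1..n} (rot n k)"
proof -
  have descent: "i \<le> n - k \<and> n - k < j"
    if "1 \<le> i" "i < j" "j \<le> n" "rot n k j < rot n k i" for i j
    using that assms by (auto simp: rot_def split: if_splits)
  have ascent: "j \<le> n - k \<or> n - k < i"
    if "1 \<le> i" "i < j" "j \<le> n" "rot n k i < rot n k j" for i j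
    using that assms by (auto simp: rot_def split: if_splits)
  show "\<not> has132 {1..n} (rot n k)"
  proof
    assume "has132 {1..n} (rot n k)"
    then obtain a b c where "a \<in> {1..n}" "b \<in> {1..n}" "c \<in> {1..n}" "a < b" "b < c"
      "rot n k a < rot n k c" "rot n k c < rot n k b" unfolding has132_def by blast
    then show False using descent[of b c] ascent[of a c] by auto
  qed
  show "\<not> has3421 {1..n} (rot n k)"
  proof
    assume "has3421 {1..n} (rot n k)"
    then obtain a b c d where "a \<in> {1..n}" "b \<in> {1..n}" "c \<in> {1..n}" "d \<in> {1..n}"
      "a < b" "b < c" "c < d" "rot n k d < rot n k c" "rot n k c < rot n k a"
      unfolding has3421_def by blast
    then show False using descent[of c d] descent[of a c] by auto
  qed
qed

lemma rot_rot:
  assumes "k \<le> n"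
  shows "rot n k \<circ> rot n k = rot n (if 2 * k \<le> n then 2 * k else 2 * k - n)"
proof
  fix i
  consider "1 \<le> i" "i \<le> n - k" | "n - k < i" "i \<le> n" | "i = 0" | "n < i" by linarith
  then show "(rot n k \<circ> rot n k) i = rot n (if 2 * k \<le> n then 2 * k else 2 * k - n) i"
    using assms by cases (auto simp: rot_def)
qed

section \<open>The three valley families belong to the set\<close>

lemma valley_swap_permutes:
  assumes "r \<in> {2..n-1}"
  shows "valley_swap n r permutes {1..n}"
proof (rule permutes_if_inj_on_endo)
  show "inj_on (valley_swap n r) {1..n}"
    by (rule inj_on_inverseI[of _ "valley_swap n r"])
      (use assms in \<open>auto simp: valley_def valley_swap_def\<close>)
qed (use assms in \<open>auto simp: valley_def valley_swap_def\<close>)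

lemma valley_cycle_permutes:
  assumes "r \<in> {2..n-2}"
  shows "valley_cycle n r permutes {1..n}"
proof (rule permutes_if_inj_on_endo)
  show "inj_on (valley_cycle n r) {1..n}"
    by (rule inj_on_inverseI[of _ "valley_cycle_inv n r"])
      (use assms in \<open>auto simp: valley_def valley_cycle_def valley_cycle_inv_def\<close>)
qed (use assms in \<open>auto simp: valley_def valley_cycle_def\<close>)

lemma valley_cycle_inv_permutes:
  assumes "r \<in> {2..n-2}"
  shows "valley_cycle_inv n r permutes {1..n}"
proof (rule permutes_if_inj_on_endo)
  show "inj_on (valley_cycle_inv n r) {1..n}"
    by (rule inj_on_inverseI[of _ "valley_cycle n r"])
      (use assms in \<open>auto simp: valley_def valley_cycle_inv_def valley_cycle_def\<close>)
qed (use assms in \<open>auto simp: valley_def valley_cycle_inv_def\<close>)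

text \<open>An ascent must end beyond \<open>r\<close>, where \<open>valley r\<close> is the
  identity. This rules out 132, 231 and hence the 342 of a 3421 in the middle.\<close>

lemma valley_no_peak: "\<lbrakk>2 \<le> a; a < b; b < c; valley r a < valley r b\<rbrakk> \<Longrightarrow> valley r b \<le> valley r c"
  by (auto simp: valley_def split: if_splits)

text \<open>The extreme entries at both ends force the first three entries of either pattern into
  the middle block, where there is no peak. The other two families are treated in the same
  way.\<close>

lemma valley_swap_avoids:
  assumes r: "r \<in> {2..n-1}"
  shows "\<not> has132 {1..n} (valley_swap n r)" "\<not> has3421 {1..n} (valley_swap n r)"
proof -
  let ?f = "valley_swap n r"
  note P = permutes_interval_facts(1)[OF valley_swap_permutes[OF r]]
  have ends: "?f 1 = n" "?f n = 1" "n \<ge> 3"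
    using r by (auto simp: valley_swap_def)
  have "?f i = valley r i" if "2 \<le> i" "i \<le> n - 1" for i
    using that by (auto simp: valley_swap_def)
  then have no_peak: False if "2 \<le> a" "a < b" "b < c" "c \<le> n - 1" "?f a < ?f b" "?f c < ?f b" for a b c
    using valley_no_peak[of a b c r] that by auto
  show "\<not> has132 {1..n} ?f"
  proof
    assume "has132 {1..n} ?f"
    then obtain a b c where H: "a \<in> {1..n}" "b \<in> {1..n}" "c \<in> {1..n}"
      "a < b" "b < c" "?f a < ?f c" "?f c < ?f b" unfolding has132_def by blast
    then have B: "1 \<le> ?f a" "?f b \<le> n" using P by auto
    have "a \<noteq> 1" using ends B H by auto
    moreover have "c \<noteq> n" using ends B H by auto
    ultimately have "2 \<le> a" "c \<le> n - 1" using H by auto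
    then show False using no_peak[of a b c] H by auto
  qed
  show "\<not> has3421 {1..n} ?f"
  proof
    assume "has3421 {1..n} ?f"
    then obtain a b c d where H: "a \<in> {1..n}" "b \<in> {1..n}" "c \<in> {1..n}" "d \<in> {1..n}"
      "a < b" "b < c" "c < d" "?f d < ?f c" "?f c < ?f a" "?f a < ?f b"
      unfolding has3421_def by blast
    then have B: "1 \<le> ?f d" "?f b \<le> n" using P by auto
    have "a \<noteq> 1" using ends B H by auto
    moreover have "c \<noteq> n" using H by auto
    ultimately have "2 \<le> a" "c \<le> n - 1" using H by auto
    then show False using no_peak[of a b c] H by auto
  qed
qed

lemma valley_cycle_avoids:
  assumes r: "r \<in> {2..n-2}"
  shows "\<not> has132 {1..n} (valley_cycle n r)" "\<not> has3421 {1..n} (valley_cycle n r)"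
proof -
  let ?f = "valley_cycle n r"
  note P = permutes_interval_facts(1)[OF valley_cycle_permutes[OF r]]
  note inj = permutes_interval_facts(2)[OF valley_cycle_permutes[OF r]]
  have ends: "?f 1 = n - 1" "?f (n - 1) = n" "?f n = 1" "n \<ge> 4"
    using r by (auto simp: valley_cycle_def)
  have "?f i = valley r i" if "2 \<le> i" "i \<le> n - 2" for i
    using that by (auto simp: valley_cycle_def)
  then have no_peak: False if "2 \<le> a" "a < b" "b < c" "c \<le> n - 2" "?f a < ?f b" "?f c < ?f b" for a b c
    using valley_no_peak[of a b c r] that by auto
  show "\<not> has132 {1..n} ?f"
  proof
    assume "has132 {1..n} ?f"
    then obtain a b c where H: "a \<in> {1..n}" "b \<in> {1..n}" "c \<in> {1..n}"
      "a < b" "b < c" "?f a < ?f c" "?f c < ?f b" unfolding has132_def by blast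
    then have B: "1 \<le> ?f a" "?f b \<le> n" using P by auto
    have cn: "c \<noteq> n" using ends B H by auto
    moreover have c1: "c \<noteq> n - 1" using ends B H by auto
    moreover have "a \<noteq> 1"
    proof
      \<comment> \<open>Only \<open>n\<close> exceeds the first entry \<open>n - 1\<close>, and
        after \<open>n\<close> just position \<open>n\<close> remains, which \<open>c\<close> cannot
        be.\<close>
      assume "a = 1"
      then have "?f b = n" using ends B H by auto
      then have "b = n - 1" using ends inj by metis
      then show False using H cn by auto
    qed
    ultimately have "2 \<le> a" "c \<le> n - 2" using H by auto
    then show False using no_peak[of a b c] H by auto
  qed
  show "\<not> has3421 {1..n} ?f"
  proof
    assume "has3421 {1..n} ?f"
    then obtain a b c d where H: "a \<in> {1..n}" "b \<in> {1..n}" "c \<in> {1..n}" "d \<in> {1..n}"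
      "a < b" "b < c" "c < d" "?f d < ?f c" "?f c < ?f a" "?f a < ?f b"
      unfolding has3421_def by blast
    then have B: "1 \<le> ?f d" "?f b \<le> n" using P by auto
    have cn: "c \<noteq> n" using H by auto
    moreover have c1: "c \<noteq> n - 1" using ends B H by auto
    moreover have "a \<noteq> 1"
    proof
      assume "a = 1"
      then have "?f b = n" using ends B H by auto
      then have "b = n - 1" using ends inj by metis
      then show False using H cn by auto
    qed
    ultimately have "2 \<le> a" "c \<le> n - 2" using H by auto
    then show False using no_peak[of a b c] H by auto
  qed
qed

lemma valley_cycle_inv_avoids:
  assumes r: "r \<in> {2..n-2}"
  shows "\<not> has132 {1..n} (valley_cycle_inv n r)" "\<not> has3421 {1..n} (valley_cycle_inv n r)"
proof -
  let ?f = "valley_cycle_inv n r"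
  note P = permutes_interval_facts(1)[OF valley_cycle_inv_permutes[OF r]]
  note inj = permutes_interval_facts(2)[OF valley_cycle_inv_permutes[OF r]]
  have ends: "?f 1 = n" "?f (n - 1) = 1" "?f n = n - 1" "n \<ge> 4"
    using r by (auto simp: valley_cycle_inv_def)
  have "?f i = valley r i" if "2 \<le> i" "i \<le> n - 2" for i
    using that by (auto simp: valley_cycle_inv_def)
  then have no_peak: False if "2 \<le> a" "a < b" "b < c" "c \<le> n - 2" "?f a < ?f b" "?f c < ?f b" for a b c
    using valley_no_peak[of a b c r] that by auto
  show "\<not> has132 {1..n} ?f"
  proof
    assume "has132 {1..n} ?f"
    then obtain a b c where H: "a \<in> {1..n}" "b \<in> {1..n}" "c \<in> {1..n}"
      "a < b" "b < c" "?f a < ?f c" "?f c < ?f b" unfolding has132_def by blast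
    then have B: "1 \<le> ?f a" "?f b \<le> n" using P by auto
    have "a \<noteq> 1" using ends B H by auto
    moreover have "c \<noteq> n"
    proof
      \<comment> \<open>Only the first entry exceeds the last one, and nothing precedes it to be the
        1.\<close>
      assume "c = n"
      then have "?f b = n" using ends B H by auto
      then have "b = 1" using ends inj by metis
      then show False using H by auto
    qed
    moreover have "c \<noteq> n - 1" using ends B H by auto
    ultimately have "2 \<le> a" "c \<le> n - 2" using H by auto
    then show False using no_peak[of a b c] H by auto
  qed
  show "\<not> has3421 {1..n} ?f"
  proof
    assume "has3421 {1..n} ?f"
    then obtain a b c d where H: "a \<in> {1..n}" "b \<in> {1..n}" "c \<in> {1..n}" "d \<in> {1..n}"
      "a < b" "b < c" "c < d" "?f d < ?f c" "?f c < ?f a" "?f a < ?f b"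
      unfolding has3421_def by blast
    then have B: "1 \<le> ?f d" "?f b \<le> n" using P by auto
    have "a \<noteq> 1" using ends B H by auto
    moreover have "c \<noteq> n" using H by auto
    moreover have "c \<noteq> n - 1" using ends B H by auto
    ultimately have "2 \<le> a" "c \<le> n - 2" using H by auto
    then show False using no_peak[of a b c] H by auto
  qed
qed

lemma valley_in_range:
  assumes "2 \<le> r" "r \<le> u" "2 \<le> i" "i \<le> u"
  shows "2 \<le> valley r i \<and> valley r i \<le> u"
  using assms by (auto simp: valley_def)

lemma valley_valley: "valley r (valley r i) = i"
  by (auto simp: valley_def)

lemma valley_2: "valley 2 i = i"
  by (auto simp: valley_def)

text \<open>The swap and the reversal are both involutions. The identity is written
  \<open>rot n 0\<close> so that \<open>rot_avoids\<close> covers the square.\<close>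

lemma valley_swap_square:
  assumes r: "r \<in> {2..n-1}"
  shows "valley_swap n r \<circ> valley_swap n r = rot n 0"
proof
  fix i
  have n: "3 \<le> n" using r by auto
  have ends: "valley_swap n r 1 = n" "valley_swap n r n = 1"
    using n by (simp_all add: valley_swap_def)
  have inner: "valley_swap n r j = valley r j" if "2 \<le> j \<and> j \<le> n - 1" for j
    using that n by (auto simp: valley_swap_def)
  have "valley_swap n r (valley_swap n r i) = i"
  proof (cases "2 \<le> i \<and> i \<le> n - 1")
    case True
    then have "2 \<le> valley r i \<and> valley r i \<le> n - 1"
      using r by (intro valley_in_range) auto
    with True show ?thesis by (simp only: inner valley_valley)
  next
    case False
    then consider "i = 1" | "i = n" | "\<not> (1 \<le> i \<and> i \<le> n)" by linarith
    then show ?thesis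
    proof cases
      case 3
      then show ?thesis using permutes_interval_facts(4)[OF valley_swap_permutes[OF r]] by metis
    qed (simp_all only: ends)
  qed
  then show "(valley_swap n r \<circ> valley_swap n r) i = rot n 0 i" by (simp add: rot_def)
qed

lemma valley_cycle_values:
  assumes "4 \<le> n"
  shows "valley_cycle n r 1 = n - 1" "valley_cycle n r (n - 1) = n" "valley_cycle n r n = 1"
    and "2 \<le> i \<and> i \<le> n - 2 \<Longrightarrow> valley_cycle n r i = valley r i"
  using assms by (auto simp: valley_cycle_def)

lemma valley_cycle_inv_values:
  assumes "4 \<le> n"
  shows "valley_cycle_inv n r 1 = n" "valley_cycle_inv n r (n - 1) = 1" "valley_cycle_inv n r n = n - 1"
    and "2 \<le> i \<and> i \<le> n - 2 \<Longrightarrow> valley_cycle_inv n r i = valley r i"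
  using assms by (auto simp: valley_cycle_inv_def)

text \<open>The reversal cancels and the 3-cycle on \<open>1\<close>, \<open>n - 1\<close>,
  \<open>n\<close> turns into its inverse. As \<open>valley 2\<close> is the identity, the square is
  a member of the inverse family.\<close>

lemma valley_cycle_square:
  assumes r: "r \<in> {2..n-2}"
  shows "valley_cycle n r \<circ> valley_cycle n r = valley_cycle_inv n 2"
proof
  fix i
  have n: "4 \<le> n" and two: "2 \<in> {2..n-2}" using r by auto
  note vals = valley_cycle_values[OF n] valley_cycle_inv_values[OF n]
  show "(valley_cycle n r \<circ> valley_cycle n r) i = valley_cycle_inv n 2 i"
  proof (cases "2 \<le> i \<and> i \<le> n - 2")
    case True
    then have "2 \<le> valley r i \<and> valley r i \<le> n - 2"
      using r by (intro valley_in_range) auto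
    with True show ?thesis by (simp only: o_apply vals valley_valley valley_2)
  next
    case False
    then consider "i = 1" | "i = n - 1" | "i = n" | "\<not> (1 \<le> i \<and> i \<le> n)" by linarith
    then show ?thesis
    proof cases
      case 4
      then show ?thesis
        using permutes_interval_facts(4)[OF valley_cycle_permutes[OF r]]
          permutes_interval_facts(4)[OF valley_cycle_inv_permutes[OF two]] by (metis o_apply)
    qed (simp_all only: o_apply vals)
  qed
qed

lemma valley_cycle_inv_square:
  assumes r: "r \<in> {2..n-2}"
  shows "valley_cycle_inv n r \<circ> valley_cycle_inv n r = valley_cycle n 2"
proof
  fix i
  have n: "4 \<le> n" and two: "2 \<in> {2..n-2}" using r by auto
  note vals = valley_cycle_values[OF n] valley_cycle_inv_values[OF n]
  show "(valley_cycle_inv n r \<circ> valley_cycle_inv n r) i = valley_cycle n 2 i"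
  proof (cases "2 \<le> i \<and> i \<le> n - 2")
    case True
    then have "2 \<le> valley r i \<and> valley r i \<le> n - 2"
      using r by (intro valley_in_range) auto
    with True show ?thesis by (simp only: o_apply vals valley_valley valley_2)
  next
    case False
    then consider "i = 1" | "i = n - 1" | "i = n" | "\<not> (1 \<le> i \<and> i \<le> n)" by linarith
    then show ?thesis
    proof cases
      case 4
      then show ?thesis
        using permutes_interval_facts(4)[OF valley_cycle_inv_permutes[OF r]]
          permutes_interval_facts(4)[OF valley_cycle_permutes[OF two]] by (metis o_apply)
    qed (simp_all only: o_apply vals)
  qed
qed

text \<open>One inclusion splits on the position of \<open>n\<close>; the other uses that squares of
  the listed words are listed words or the identity, all of which avoid both patterns.\<close>

lemma SAv_132_3421_nonfixing:
  "{p \<in> SAv n {[1,3,2], [3,4,2,1]}. p n \<noteq> n} =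
     rot n ` {1..n-1} \<union> valley_swap n ` {2..n-1} \<union> valley_cycle n ` {2..n-2}
       \<union> valley_cycle_inv n ` {2..n-2}" (is "?L = ?R")
proof (intro equalityI subsetI)
  fix p assume "p \<in> ?L"
  then have p: "p permutes {1..n}" and ne: "p n \<noteq> n"
    and av: "\<not> has132 {1..n} p" "\<not> has3421 {1..n} p"
      "\<not> has132 {1..n} (p \<circ> p)" "\<not> has3421 {1..n} (p \<circ> p)"
    unfolding mem_Collect_eq mem_SAv_132_3421_iff by blast+
  note P = permutes_interval_facts[OF p]
  have "1 \<le> n" using P(4)[of n] ne by force
  then obtain m where m: "1 \<le> m" "m \<le> n" "p m = n" using P(3)[of n] by auto
  with ne have "m < n" by (cases "m = n") auto
  show "p \<in> ?R"
  proof (cases "m = 1")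
    case True
    then have "2 \<le> n" "p 1 = n" "n - 1 \<in> {1..n-1}" using m \<open>m < n\<close> by auto
    with max_first_classification[OF p _ av] show ?thesis by blast
  next
    case False
    then have "2 \<le> m" "n - m \<in> {1..n-1}" using m \<open>m < n\<close> by auto
    with max_middle_classification[OF p av _ \<open>m < n\<close> m(3)] show ?thesis by blast
  qed
next
  fix p assume "p \<in> ?R"
  then consider k where "k \<in> {1..n-1}" "p = rot n k" | r where "r \<in> {2..n-1}" "p = valley_swap n r"
    | r where "r \<in> {2..n-2}" "p = valley_cycle n r"
    | r where "r \<in> {2..n-2}" "p = valley_cycle_inv n r" by blast
  then show "p \<in> ?L"
  proof cases
    case 1
    let ?k = "if 2 * k \<le> n then 2 * k else 2 * k - n"
    have k: "k \<le> n" "?k \<le> n" using 1 by auto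
    have "p n \<noteq> n" using 1 by (auto simp: rot_def)
    then show ?thesis
      unfolding mem_Collect_eq mem_SAv_132_3421_iff 1(2) rot_rot[OF k(1)]
      using rot_permutes[OF k(1)] rot_avoids[OF k(1)] rot_avoids[OF k(2)] by blast
  next
    case 2
    have "p n \<noteq> n" using 2 by (auto simp: valley_swap_def)
    then show ?thesis
      unfolding mem_Collect_eq mem_SAv_132_3421_iff 2(2) valley_swap_square[OF 2(1)]
      using valley_swap_permutes[OF 2(1)] valley_swap_avoids[OF 2(1)] rot_avoids[of 0 n] by blast
  next
    case 3
    have "p n \<noteq> n" "2 \<in> {2..n-2}" using 3 by (auto simp: valley_cycle_def)
    then show ?thesis
      unfolding mem_Collect_eq mem_SAv_132_3421_iff 3(2) valley_cycle_square[OF 3(1)]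
      using valley_cycle_permutes[OF 3(1)] valley_cycle_avoids[OF 3(1)] valley_cycle_inv_avoids[of 2 n]
      by blast
  next
    case 4
    have "p n \<noteq> n" "2 \<in> {2..n-2}" using 4 by (auto simp: valley_cycle_inv_def)
    then show ?thesis
      unfolding mem_Collect_eq mem_SAv_132_3421_iff 4(2) valley_cycle_inv_square[OF 4(1)]
      using valley_cycle_inv_permutes[OF 4(1)] valley_cycle_inv_avoids[OF 4(1)]
        valley_cycle_avoids[of 2 n] by blast
  qed
qed

text \<open>The parameter of a rotation is its entry at \<open>n\<close>, that of the other words
  their entry at \<open>2\<close>. Truncated subtraction matches the empty index ranges for small
  \<open>n\<close>.\<close>

lemma card_SAv_132_3421_nonfixing:
  "card {p \<in> SAv n {[1,3,2], [3,4,2,1]}. p n \<noteq> n} = (n - 1) + (n - 2) + 2 * (n - 3)"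
proof -
  have val: "valley_swap n r 2 = r" if "r \<in> {2..n-1}" for r
    using that by (auto simp: valley_swap_def valley_def)
  have val': "valley_cycle n r 2 = r" "valley_cycle_inv n r 2 = r" if "r \<in> {2..n-2}" for r
    using that by (auto simp: valley_cycle_def valley_cycle_inv_def valley_def)
  have "inj_on (rot n) {1..n-1}"
    by (rule inj_on_inverseI[of _ "\<lambda>p. p n"]) (auto simp: rot_def)
  moreover have "inj_on (valley_swap n) {2..n-1}"
    by (rule inj_on_inverseI[of _ "\<lambda>p. p 2"]) (rule val)
  moreover have "inj_on (valley_cycle n) {2..n-2}" "inj_on (valley_cycle_inv n) {2..n-2}"
    by (rule inj_on_inverseI[of _ "\<lambda>p. p 2"]; rule val'; assumption)+
  moreover have "rot n ` {1..n-1} \<inter> valley_swap n ` {2..n-1} = {}"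
  proof -
    have "rot n k \<noteq> valley_swap n r" if "k \<in> {1..n-1}" "r \<in> {2..n-1}" for k r
    proof
      assume "rot n k = valley_swap n r"
      then have "rot n k n = valley_swap n r n" "rot n k 1 = valley_swap n r 1" by simp_all
      then show False using that by (auto simp: rot_def valley_swap_def split: if_splits)
    qed
    then show ?thesis by blast
  qed
  moreover have "(rot n ` {1..n-1} \<union> valley_swap n ` {2..n-1}) \<inter> valley_cycle n ` {2..n-2} = {}"
  proof -
    have "rot n k \<noteq> valley_cycle n r" if "k \<in> {1..n-1}" "r \<in> {2..n-2}" for k r
    proof
      assume "rot n k = valley_cycle n r"
      then have "rot n k n = valley_cycle n r n" "rot n k 1 = valley_cycle n r 1" by simp_all
      then show False using that by (auto simp: rot_def valley_cycle_def split: if_splits)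
    qed
    moreover have "valley_swap n s \<noteq> valley_cycle n r" if "s \<in> {2..n-1}" "r \<in> {2..n-2}" for s r
    proof
      assume "valley_swap n s = valley_cycle n r"
      then have "valley_swap n s 1 = valley_cycle n r 1" by simp
      then show False using that by (auto simp: valley_swap_def valley_cycle_def)
    qed
    ultimately show ?thesis by blast
  qed
  moreover have "(rot n ` {1..n-1} \<union> valley_swap n ` {2..n-1} \<union> valley_cycle n ` {2..n-2})
      \<inter> valley_cycle_inv n ` {2..n-2} = {}"
  proof -
    have "rot n k \<noteq> valley_cycle_inv n r" if "k \<in> {1..n-1}" "r \<in> {2..n-2}" for k r
    proof
      assume "rot n k = valley_cycle_inv n r"
      \<comment> \<open>The entries at \<open>1\<close> and \<open>n\<close> would not do:
        \<open>rot n (n - 1)\<close> agrees with \<open>valley_cycle_inv n r\<close> there, and only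
        the entry at \<open>2\<close> separates them.\<close>
      then have "rot n k n = valley_cycle_inv n r n" "rot n k 2 = valley_cycle_inv n r 2"
        by simp_all
      then show False using that val'(2)[of r]
        by (auto simp: rot_def valley_cycle_inv_def split: if_splits)
    qed
    moreover have "valley_swap n s \<noteq> valley_cycle_inv n r" if "s \<in> {2..n-1}" "r \<in> {2..n-2}" for s r
    proof
      assume "valley_swap n s = valley_cycle_inv n r"
      then have "valley_swap n s n = valley_cycle_inv n r n" by simp
      moreover have "n \<ge> 4" using that by auto
      moreover from this have "valley_swap n s n = 1" "valley_cycle_inv n r n = n - 1"
        by (simp_all add: valley_swap_def valley_cycle_inv_def)
      ultimately show False by linarith
    qed
    moreover have "valley_cycle n s \<noteq> valley_cycle_inv n r" if "s \<in> {2..n-2}" "r \<in> {2..n-2}" for s r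
    proof
      assume "valley_cycle n s = valley_cycle_inv n r"
      then have "valley_cycle n s 1 = valley_cycle_inv n r 1" by simp
      then show False using that by (simp add: valley_cycle_def valley_cycle_inv_def)
    qed
    ultimately show ?thesis by blast
  qed
  ultimately show ?thesis
    unfolding SAv_132_3421_nonfixing by (simp add: card_Un_disjoint card_image)
qed

section \<open>Recursion through the permutations that fix the last point\<close>

lemma has132_Suc_fixed:
  assumes "f permutes {1..n}"
  shows "has132 {1..Suc n} f \<longleftrightarrow> has132 {1..n} f"
proof
  note P = permutes_interval_facts[OF assms]
  assume "has132 {1..Suc n} f"
  then obtain a b c where H: "a \<in> {1..Suc n}" "b \<in> {1..Suc n}" "c \<in> {1..Suc n}"
    "a < b" "b < c" "f a < f c" "f c < f b" unfolding has132_def by blast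
  \<comment> \<open>The fixed last entry is the largest, so it cannot be the 2 of a 132; likewise it
    cannot be the 1 of a 3421.\<close>
  then have "c \<noteq> Suc n" using P(1)[of b] P(4)[of c] by auto
  with H show "has132 {1..n} f" by (intro has132I[of a _ b c]) auto
qed (auto elim: has132_mono)

lemma has3421_Suc_fixed:
  assumes "f permutes {1..n}"
  shows "has3421 {1..Suc n} f \<longleftrightarrow> has3421 {1..n} f"
proof
  note P = permutes_interval_facts[OF assms]
  assume "has3421 {1..Suc n} f"
  then obtain a b c d where H: "a \<in> {1..Suc n}" "b \<in> {1..Suc n}" "c \<in> {1..Suc n}"
    "d \<in> {1..Suc n}" "a < b" "b < c" "c < d" "f d < f c" "f c < f a" "f a < f b"
    unfolding has3421_def by blast
  then have "d \<noteq> Suc n" using P(1)[of b] P(4)[of d] by auto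
  with H show "has3421 {1..n} f" by (intro has3421I[of a _ b c d]) auto
qed (auto elim: has3421_mono)

lemma permutes_Suc_fixed_iff:
  "p permutes {1..Suc n} \<and> p (Suc n) = Suc n \<longleftrightarrow> p permutes {1..n}"
proof
  assume *: "p permutes {1..Suc n} \<and> p (Suc n) = Suc n"
  show "p permutes {1..n}"
    by (rule permutes_superset[of p "{1..Suc n}"]) (use * in \<open>auto simp: le_Suc_eq\<close>)
next
  assume *: "p permutes {1..n}"
  show "p permutes {1..Suc n} \<and> p (Suc n) = Suc n"
    using permutes_subset[OF *, of "{1..Suc n}"] permutes_not_in[OF *, of "Suc n"] by auto
qed

text \<open>A plain equality of sets of functions, because a permutation of \<open>{1..n}\<close> is
  a total function that already fixes \<open>Suc n\<close>.\<close>

lemma SAv_132_3421_fixing: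
  "{p \<in> SAv (Suc n) {[1,3,2], [3,4,2,1]}. p (Suc n) = Suc n} = SAv n {[1,3,2], [3,4,2,1]}"
proof -
  have "p \<in> SAv (Suc n) {[1,3,2], [3,4,2,1]} \<and> p (Suc n) = Suc n
      \<longleftrightarrow> p \<in> SAv n {[1,3,2], [3,4,2,1]}" for p
  proof (cases "p permutes {1..n}")
    case True
    have pp: "p \<circ> p permutes {1..n}" using True True by (rule permutes_compose)
    show ?thesis
      unfolding mem_SAv_132_3421_iff has132_Suc_fixed[OF True] has3421_Suc_fixed[OF True]
        has132_Suc_fixed[OF pp] has3421_Suc_fixed[OF pp]
      using permutes_Suc_fixed_iff[of p n] by blast
  next
    case False
    then show ?thesis
      unfolding mem_SAv_132_3421_iff using permutes_Suc_fixed_iff[of p n] by blast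
  qed
  then show ?thesis by blast
qed

lemma finite_SAv: "finite (SAv n T)"
  by (rule finite_subset[OF _ finite_permutations[of "{1..n}"]]) (auto simp: SAv_def)

lemma card_SAv_132_3421_Suc:
  "card (SAv (Suc n) {[1,3,2], [3,4,2,1]}) =
     card (SAv n {[1,3,2], [3,4,2,1]}) + (n + (n - 1) + 2 * (n - 2))"
proof -
  let ?S = "SAv (Suc n) {[1,3,2], [3,4,2,1]}"
  have "card ?S = card ({p \<in> ?S. p (Suc n) = Suc n} \<union> {p \<in> ?S. p (Suc n) \<noteq> Suc n})"
    by (rule arg_cong[where f = card]) blast
  also have "\<dots> = card {p \<in> ?S. p (Suc n) = Suc n} + card {p \<in> ?S. p (Suc n) \<noteq> Suc n}"
    by (rule card_Un_disjoint) (auto simp: finite_SAv)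
  finally show ?thesis
    unfolding SAv_132_3421_fixing card_SAv_132_3421_nonfixing by simp
qed

lemma card_SAv_132_3421:
  assumes "n \<ge> 2"
  shows "int (card (SAv n {[1,3,2], [3,4,2,1]})) = 2 * (int n)^2 - 7 * int n + 8"
  using assms
proof (induction n rule: dec_induct)
  case base
  \<comment> \<open>The formula fails for \<open>n = 0\<close> and \<open>n = 1\<close>, so the base
    case \<open>n = 2\<close> is reached from \<open>0\<close> by two uses of the recursion.\<close>
  have "SAv 0 {[1,3,2], [3,4,2,1]} = {id}"
    by (auto simp: SAv_def avoids_def occurrence_def)
  then show ?case
    using card_SAv_132_3421_Suc[of 0] card_SAv_132_3421_Suc[of 1] by (simp add: numeral_2_eq_2)
next
  case (step n)
  then show ?case
    unfolding card_SAv_132_3421_Suc by (simp add: of_nat_diff power2_eq_square algebra_simps)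
qed

section \<open>Reverse-complement\<close>

definition refl_perm :: "nat \<Rightarrow> nat \<Rightarrow> nat" where
  "refl_perm n i = (if 1 \<le> i \<and> i \<le> n then n + 1 - i else i)"

lemma refl_perm_refl_perm [simp]: "refl_perm n (refl_perm n i) = i"
  by (auto simp: refl_perm_def)

lemma refl_perm_permutes: "refl_perm n permutes {1..n}"
  by (rule permutes_if_inj_on_endo) (auto simp: refl_perm_def inj_on_def)

definition rev_compl :: "nat \<Rightarrow> (nat \<Rightarrow> nat) \<Rightarrow> nat \<Rightarrow> nat" where
  "rev_compl n p = refl_perm n \<circ> p \<circ> refl_perm n"

lemma rev_compl_rev_compl [simp]: "rev_compl n (rev_compl n p) = p"
  by (auto simp: rev_compl_def)

text \<open>The two inner reflections cancel; with \<open>p = q\<close> this makes conjugation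
  commute with squaring.\<close>

lemma rev_compl_comp: "rev_compl n p \<circ> rev_compl n q = rev_compl n (p \<circ> q)"
  by (auto simp: rev_compl_def)

lemma rev_compl_permutes: "p permutes {1..n} \<Longrightarrow> rev_compl n p permutes {1..n}"
  unfolding rev_compl_def by (intro permutes_compose refl_perm_permutes)

text \<open>Order isomorphism of \<open>\<sigma>\<close> with the reverse-complement of
  \<open>\<tau>\<close>: the mirrored indices reverse, and the exchanged sides of the comparison
  complement. For concrete patterns it is checked by simplification.\<close>

definition rev_compl_pattern :: "nat list \<Rightarrow> nat list \<Rightarrow> bool" where
  "rev_compl_pattern \<sigma> \<tau> \<longleftrightarrow> length \<sigma> = length \<tau> \<and>
     (\<forall>j < length \<tau>. \<forall>l < length \<tau>.
        \<sigma> ! j < \<sigma> ! l \<longleftrightarrow> \<tau> ! (length \<tau> - 1 - l) < \<tau> ! (length \<tau> - 1 - j))"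

text \<open>Reflection inverts the order of positions, so the occurrence is read backwards to be
  increasing again; it also inverts comparisons of values, as the relation between the patterns
  demands.\<close>

lemma occurrence_rev_compl:
  assumes p: "p permutes {1..n}" and rc: "rev_compl_pattern \<sigma> \<tau>" and occ: "occurrence \<tau> n p i"
  shows "occurrence \<sigma> n (rev_compl n p) (\<lambda>j. refl_perm n (i (length \<tau> - 1 - j)))"
proof -
  note P = permutes_interval_facts[OF p]
  let ?m = "length \<tau>"
  define i' where "i' j = i (?m - 1 - j)" for j
  have len: "length \<sigma> = ?m" using rc by (simp add: rev_compl_pattern_def)
  have rng: "1 \<le> i' j \<and> i' j \<le> n" if "j < ?m" for j
    using occ that by (simp add: occurrence_def i'_def)
  have mono: "i' l < i' j" if "j < l" "l < ?m" for j l
  proof -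
    have "strict_mono_on {..<?m} i" using occ by (simp add: occurrence_def)
    then show ?thesis unfolding i'_def by (rule strict_mono_onD) (use that in auto)
  qed
  have pat: "p (i' l) < p (i' j) \<longleftrightarrow> \<sigma> ! j < \<sigma> ! l" if "j < ?m" "l < ?m" for j l
  proof -
    have "?m - 1 - j < ?m" "?m - 1 - l < ?m" using that by auto
    then have "p (i' l) < p (i' j) \<longleftrightarrow> \<tau> ! (?m - 1 - l) < \<tau> ! (?m - 1 - j)"
      using occ unfolding occurrence_def i'_def by blast
    then show ?thesis using rc that unfolding rev_compl_pattern_def by blast
  qed
  have refl_less: "refl_perm n x < refl_perm n y \<longleftrightarrow> y < x"
    if "1 \<le> x \<and> x \<le> n" "1 \<le> y \<and> y \<le> n" for x y
    using that by (auto simp: refl_perm_def)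
  have "refl_perm n (i' j) \<in> {1..n}" if "j < ?m" for j
    using rng[OF that] permutes_in_image[OF refl_perm_permutes] by auto
  moreover have "refl_perm n (i' j) < refl_perm n (i' l)" if "j < l" "l < ?m" for j l
    using refl_less[of "i' j" "i' l"] rng[of j] rng[of l] mono[OF that] that by simp
  moreover have "rev_compl n p (refl_perm n (i' j)) < rev_compl n p (refl_perm n (i' l))
      \<longleftrightarrow> \<sigma> ! j < \<sigma> ! l" if "j < ?m" "l < ?m" for j l
    using refl_less[of "p (i' j)" "p (i' l)"] P(1)[of "i' j"] P(1)[of "i' l"]
      rng[OF that(1)] rng[OF that(2)] pat[OF that] by (simp add: rev_compl_def)
  ultimately show ?thesis
    unfolding occurrence_def len strict_mono_on_def i'_def[symmetric] by simp
qed

text \<open>By contraposition: \<open>rev_compl n\<close> is an involution, so an occurrence of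
  \<open>\<sigma>\<close> in the image is carried back to one of \<open>\<tau>\<close> in
  \<open>p\<close>.\<close>

lemma avoids_rev_compl:
  assumes "p permutes {1..n}" "rev_compl_pattern \<tau> \<sigma>" "avoids n p \<tau>"
  shows "avoids n (rev_compl n p) \<sigma>"
  using assms(3) occurrence_rev_compl[OF rev_compl_permutes[OF assms(1)] assms(2)]
  unfolding avoids_def rev_compl_rev_compl by blast

lemma rev_compl_SAv:
  assumes "p \<in> SAv n {\<tau>, \<tau>'}" "rev_compl_pattern \<tau> \<sigma>" "rev_compl_pattern \<tau>' \<sigma>'"
  shows "rev_compl n p \<in> SAv n {\<sigma>, \<sigma>'}"
proof -
  have p: "p permutes {1..n}" and av: "avoids n p \<tau>" "avoids n p \<tau>'"
      "avoids n (p \<circ> p) \<tau>" "avoids n (p \<circ> p) \<tau>'"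
    using assms(1) unfolding SAv_def by blast+
  have pp: "p \<circ> p permutes {1..n}" using p p by (rule permutes_compose)
  show ?thesis
    unfolding SAv_def mem_Collect_eq ball_simps rev_compl_comp
    using rev_compl_permutes[OF p] avoids_rev_compl[OF p assms(2) av(1)]
      avoids_rev_compl[OF p assms(3) av(2)] avoids_rev_compl[OF pp assms(2) av(3)]
      avoids_rev_compl[OF pp assms(3) av(4)] by blast
qed

lemma card_SAv_rev_compl:
  assumes "rev_compl_pattern \<tau> \<sigma>" "rev_compl_pattern \<tau>' \<sigma>'"
    "rev_compl_pattern \<sigma> \<tau>" "rev_compl_pattern \<sigma>' \<tau>'"
  shows "card (SAv n {\<tau>, \<tau>'}) = card (SAv n {\<sigma>, \<sigma>'})"
proof (rule bij_betw_same_card)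
  show "bij_betw (rev_compl n) (SAv n {\<tau>, \<tau>'}) (SAv n {\<sigma>, \<sigma>'})"
    by (rule bij_betw_byWitness[where f' = "rev_compl n"]) (auto intro: rev_compl_SAv assms)
qed

theorem theorem1p3:
  fixes n :: nat
  assumes "n \<ge> 2"
  shows "card (SAv n {[1,3,2], [3,4,2,1]}) = card (SAv n {[2,1,3], [4,3,1,2]}) \<and>
         int (card (SAv n {[2,1,3], [4,3,1,2]})) = 2 * (int n)^2 - 7 * int n + 8"
proof -
  have "card (SAv n {[1,3,2], [3,4,2,1]}) = card (SAv n {[2,1,3], [4,3,1,2]})"
    by (rule card_SAv_rev_compl) (simp_all add: rev_compl_pattern_def all_less_Suc_conv)
  then show ?thesis using card_SAv_132_3421[OF assms] by simp
qed

end
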